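(* The measure $\mu_G$ on $\Sigma$ whose density in the inverse slope coordinate $u$ is $$\begin{cases}\dfrac{du}{u-\cot(\gamma(7\pi/8))}-\dfrac{du}{1+\sqrt2-u} & \text{if } u\in[-\infty,-1-\sqrt2],\\[2mm] \dfrac{du}{1+\sqrt2-u} & \text{if } u\in[-1-\sqrt2,1],\\[2mm] \dfrac{du}{\sqrt2-u} & \text{if } u\in[1,1+\sqrt2],\end{cases}$$ is invariant under the octagon Gauss map $G$.
   Context: Matrices: $$\gamma=\begin{pmatrix}-1&2(1+\sqrt2)\\0&1\end{pmatrix},\quad \nu_1=\tfrac1{\sqrt2}\begin{pmatrix}1&1\\1&-1\end{pmatrix},\ \nu_2=\tfrac1{\sqrt2}\begin{pmatrix}1&1\\-1&1\end{pmatrix},\ \nu_3=\begin{pmatrix}0&1\\1&0\end{pmatrix},\ \nu_4=\begin{pmatrix}0&1\\-1&0\end{pmatrix},$$ $$\nu_5=\tfrac1{\sqrt2}\begin{pmatrix}-1&1\\1&1\end{pmatrix},\ \nu_6=\tfrac1{\sqrt2}\begin{pmatrix}-1&1\\-1&-1\end{pmatrix},\ \nu_7=\begin{pmatrix}-1&0\\0&1\end{pmatrix}.$$ Points of $\mathbb{RP}^1$ are given by the inverse slope coordinate $u=x/y\in\mathbb{R}\cup\{\infty\}$ or the angle $\theta\in[0,\pi]$, $u=\cot\theta$. A matrix $L=\begin{pmatrix}a&b\\c&d\end{pmatrix}$ acts by $L[u]=\frac{au+b}{cu+d}$; $\gamma(\theta)$ denotes the action of $\gamma$ expressed in angle coordinates.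 $\Sigma_i$ is the sector with angles $[i\pi/8,(i+1)\pi/8)$ and $\Sigma=\Sigma_1\cup\dots\cup\Sigma_7$ (in the $u$ coordinate, the interval from $-\infty$ to $1+\sqrt2$). The octagon Farey map on $\Sigma$ is $F(u)=\gamma\nu_i[u]$ for $u\in\Sigma_i$, $1\le i\le7$. The octagon Gauss map $G$ is $$G(u)=\begin{cases}F^{n_1(u)}(u)=(\gamma\nu_1)^{n_1(u)}[u]&u\in\Sigma_1,\\ F(u)=\gamma\nu_i[u]&u\in\Sigma_i,\ 2\le i\le6,\\ F^{n_7(u)}(u)=(\gamma\nu_7)^{n_7(u)}[u]&u\in\Sigma_7,\end{cases}$$ where for $u\in\Sigma_k$, $k\in\{1,7\}$, $n_k(u)=\min\{n\in\mathbb{N}: F^n(u)\notin\Sigma_k\}$. Invariance means $\mu_G(G^{-1}(D))=\mu_G(D)$ for every measurable $D\subset\Sigma$.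
   Formalization: On [-∞,-1-√2] the second term is taken with a plus sign: 1/(u-cot(γ(7π/8)))+1/(1+√2-u); on [1,1+√2] the density is 1/(1+2√2-u) instead of 1/(√2-u). As printed, the density is negative on the first piece and has a non-integrable pole at u=√2. *)

theory Defs
  imports "HOL-Analysis.Analysis"
begin

text \<open>Points of \<open>RP\<^sup>1\<close> in the inverse slope coordinate \<open>u = x / y\<close>.\<close>

datatype rp1 = Finite real | Infinity

definition rp1_of_angle :: "real \<Rightarrow> rp1" where
  "rp1_of_angle \<theta> = (if sin \<theta> = 0 then Infinity else Finite (cot \<theta>))"

definition mat2 :: "real \<Rightarrow> real \<Rightarrow> real \<Rightarrow> real \<Rightarrow> real^2^2" where
  "mat2 a b c d = vector [vector [a, b], vector [c, d]]"

definition moebius :: "real^2^2 \<Rightarrow> rp1 \<Rightarrow> rp1" where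
  "moebius L p =
     (let a = L $ 1 $ 1; b = L $ 1 $ 2; c = L $ 2 $ 1; d = L $ 2 $ 2 in
      case p of
        Finite u \<Rightarrow> if c * u + d = 0 then Infinity else Finite ((a * u + b) / (c * u + d))
      | Infinity \<Rightarrow> if c = 0 then Infinity else Finite (a / c))"

text \<open>The same action on angles. The angles \<open>0\<close> and \<open>\<pi>\<close> are the same point, so a unique
  representative is obtained by taking values in \<open>[0, \<pi>)\<close>.\<close>

definition angle_action :: "real^2^2 \<Rightarrow> real \<Rightarrow> real" where
  "angle_action L \<theta> =
     (THE \<phi>. \<phi> \<in> {0..<pi} \<and> rp1_of_angle \<phi> = moebius L (rp1_of_angle \<theta>))"

definition gamma_mat :: "real^2^2" where
  "gamma_mat = mat2 (-1) (2 * (1 + sqrt 2)) 0 1"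

definition nu_mat :: "nat \<Rightarrow> real^2^2" where
  "nu_mat i =
     (if i = 1 then (1 / sqrt 2) *\<^sub>R mat2 1 1 1 (-1)
      else if i = 2 then (1 / sqrt 2) *\<^sub>R mat2 1 1 (-1) 1
      else if i = 3 then mat2 0 1 1 0
      else if i = 4 then mat2 0 1 (-1) 0
      else if i = 5 then (1 / sqrt 2) *\<^sub>R mat2 (-1) 1 1 1
      else if i = 6 then (1 / sqrt 2) *\<^sub>R mat2 (-1) 1 (-1) (-1)
      else if i = 7 then mat2 (-1) 0 0 1
      else undefined)"

definition sector :: "nat \<Rightarrow> rp1 set" where
  "sector i = rp1_of_angle ` {real i * pi / 8 ..< real (i + 1) * pi / 8}"

definition Sigma_oct :: "rp1 set" where
  "Sigma_oct = (\<Union>i\<in>{1..7}. sector i)"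

definition farey :: "rp1 \<Rightarrow> rp1" where
  "farey p =
     (if p \<in> Sigma_oct
      then moebius (gamma_mat ** nu_mat (THE i. i \<in> {1..7} \<and> p \<in> sector i)) p
      else undefined)"

text \<open>The exit time does not exist exactly at the parabolic fixed point \<open>u = 1 + \<surd>2\<close> of the first
  branch. There \<open>exit_time\<close> is an unspecified number, but every iterate of \<open>farey\<close> fixes the
  point, so that \<open>gauss\<close> fixes it, too.\<close>

definition exit_time :: "nat \<Rightarrow> rp1 \<Rightarrow> nat" where
  "exit_time k p = (LEAST n. (farey ^^ n) p \<notin> sector k)"

definition gauss :: "rp1 \<Rightarrow> rp1" where
  "gauss p =
     (if p \<in> sector 1 then (farey ^^ exit_time 1 p) p
      else if p \<in> sector 7 then (farey ^^ exit_time 7 p) p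
      else farey p)"

text \<open>
  On each piece the density is the integral of \<open>dv / (u - v)\<^sup>2\<close> over the backward endpoints \<open>v\<close>
  that occur in the natural extension, namely
    \<^item> \<open>[1 + \<surd>2, cot (\<gamma>(7\<pi>/8))]\<close> for \<open>u\<close> in the last sector, where
      \<open>cot (\<gamma>(7\<pi>/8)) = 3 (1 + \<surd>2)\<close>,
    \<^item> \<open>[1 + \<surd>2, \<infinity>]\<close> for \<open>u\<close> in the middle sectors,
    \<^item> \<open>[1 + 2\<surd>2, \<infinity>]\<close> for \<open>u\<close> in the first sector.

  The formulas differ from those of the source, which have
  \<open>1 / (u - cot (\<gamma>(7\<pi>/8))) - 1 / (1 + \<surd>2 - u)\<close> on the last sector and \<open>1 / (\<surd>2 - u)\<close> on the first.
  The former is negative there, and the latter changes sign at a non-integrable pole at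
  \<open>u = \<surd>2\<close> inside the first sector, so that they are not the density of a measure.
\<close>

definition gauss_density :: "real \<Rightarrow> real" where
  "gauss_density u =
     (if u \<le> - 1 - sqrt 2
      then 1 / (u - cot (angle_action gamma_mat (7 * pi / 8))) + 1 / (1 + sqrt 2 - u)
      else if u \<le> 1 then 1 / (1 + sqrt 2 - u)
      else 1 / (1 + 2 * sqrt 2 - u))"

text \<open>A measure whose space is \<open>Sigma_oct\<close> and whose measurable sets are the Borel subsets of
  \<open>Sigma_oct\<close> in the coordinate \<open>u\<close>.\<close>

definition mu_gauss :: "rp1 measure" where
  "mu_gauss =
     embed_measure
       (density (restrict_space lborel (Finite -` Sigma_oct)) (\<lambda>u. ennreal (gauss_density u)))
       Finite"

end

theory Submission
  imports Defs
begin

text \<open>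
  Write \<open>s = 1 + \<surd>2\<close>. The density at \<open>u\<close> is \<open>\<integral> dv / (u - v)\<^sup>2\<close> over an interval \<open>V u\<close> of
  backward endpoints: \<open>[s, 3 s]\<close> for \<open>u\<close> in the last sector, \<open>[s, \<infinity>]\<close> for \<open>u\<close> in the middle
  sectors, \<open>[2 s - 1, \<infinity>]\<close> for \<open>u\<close> in the first sector. A Moebius map \<open>M\<close> preserves
  \<open>du dv / (u - v)\<^sup>2\<close>, so if \<open>\<phi>\<close> is the inverse branch of the Gauss map on a piece where it acts
  as \<open>M\<close>, then \<open>\<phi>\<close> contributes \<open>\<integral> dv / (w - v)\<^sup>2\<close> over \<open>M (V (\<phi> w))\<close> to the density of the
  image measure at \<open>w\<close>. The intervals that arise in this way are adjacent:

    \<^item> the branches with values in the first sector exist for \<open>w \<le> 1\<close> and fill \<open>[s, 2 s - 1]\<close>;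
    \<^item> the five branches with values in the middle sectors exist for all \<open>w < s\<close> and fill
      \<open>[2 s - 1, 3 s]\<close>;
    \<^item> the branches with values in the last sector exist for \<open>w > - s\<close> and fill \<open>[3 s, \<infinity>]\<close>.

  Together they fill \<open>V w\<close> for every \<open>w < s\<close>, so the density is reproduced. This is
  \<open>branch_weights_sum\<close>; it rests on \<open>first_weights_sum\<close>, \<open>middle_weights_sum\<close> and
  \<open>last_weights_sum\<close>, where the union of adjacent intervals appears as a telescoping sum of
  reciprocals. In the two parabolic sectors the sum is infinite: the first-sector map is a
  translation in the coordinate \<open>1 / (s - u)\<close>, the last-sector map is one in \<open>u\<close> itself, and
  the exit time counts the translations.

  The passage from densities to measures is the change of variables
  \<open>inverse_branches_integral\<close>. By \<open>sector_preimages_cover\<close> the images of the inverse branches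
  exhaust the preimage of a Borel set up to six endpoints of sectors, which form a null set.
\<close>

section \<open>Change of variables along inverse branches\<close>

lemma nn_integral_change_of_variables:
  fixes f \<phi> \<phi>' :: "real \<Rightarrow> real"
  assumes S: "S \<in> sets borel" and img: "\<phi> ` S \<in> sets borel"
    and der: "\<And>x. x \<in> S \<Longrightarrow> (\<phi> has_field_derivative \<phi>' x) (at x within S)"
    and inj: "inj_on \<phi> S"
    and [measurable]: "\<phi> \<in> borel_measurable borel" "\<phi>' \<in> borel_measurable borel"
      "f \<in> borel_measurable borel"
    and nonneg: "\<And>x. x \<in> S \<Longrightarrow> 0 \<le> f (\<phi> x)"
  shows "(\<integral>\<^sup>+u\<in>\<phi> ` S. ennreal (f u) \<partial>lborel) = (\<integral>\<^sup>+x\<in>S. ennreal (\<bar>\<phi>' x\<bar> * f (\<phi> x)) \<partial>lborel)"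
proof -
  define g where "g = (\<lambda>x. \<bar>\<phi>' x\<bar> * f (\<phi> x))"
  have [measurable]: "g \<in> borel_measurable borel"
    unfolding g_def by measurable
  have g_nonneg: "0 \<le> g x" if "x \<in> S" for x
    using nonneg[OF that] by (simp add: g_def)
  \<comment> \<open>The substitution rule of \<open>Change_Of_Vars\<close> speaks of absolute integrability and
     signed integrals. For a nonnegative integrand the two together determine the nonnegative integral, which is
     infinite exactly when integrability fails.\<close>
  have key: "(\<integral>\<^sup>+u\<in>A. ennreal (h u) \<partial>lborel) =
      (if h absolutely_integrable_on A then ennreal (integral A h) else \<infinity>)"
    if A: "A \<in> sets borel" and h: "h \<in> borel_measurable borel" and pos: "\<And>u. u \<in> A \<Longrightarrow> 0 \<le> h u"
    for A and h :: "real \<Rightarrow> real"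
  proof -
    have meas: "(\<lambda>u. indicator A u *\<^sub>R h u) \<in> borel_measurable lborel"
      using A h by simp
    have ind: "(\<integral>\<^sup>+u\<in>A. ennreal (h u) \<partial>lborel) = (\<integral>\<^sup>+u. ennreal (indicator A u *\<^sub>R h u) \<partial>lborel)"
      by (intro nn_integral_cong) (auto split: split_indicator)
    have iff: "h absolutely_integrable_on A \<longleftrightarrow> integrable lborel (\<lambda>u. indicator A u *\<^sub>R h u)"
      unfolding set_integrable_def using meas by (rule integrable_completion)
    show ?thesis
    proof (cases "h absolutely_integrable_on A")
      case True
      have "integral A h = (LINT u:A|lebesgue. h u)"
        using True by (simp add: set_lebesgue_integral_eq_integral(2))
      also have "\<dots> = (LINT u|lborel. indicator A u *\<^sub>R h u)"
        unfolding set_lebesgue_integral_def using meas by (rule integral_completion)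
      finally have "ennreal (integral A h) = (\<integral>\<^sup>+u. ennreal (indicator A u *\<^sub>R h u) \<partial>lborel)"
        using True iff pos by (subst nn_integral_eq_integral) (auto split: split_indicator)
      with True show ?thesis by (simp add: ind)
    next
      case False
      have "\<not> (\<integral>\<^sup>+u. ennreal (indicator A u *\<^sub>R h u) \<partial>lborel) < \<infinity>"
      proof
        assume "(\<integral>\<^sup>+u. ennreal (indicator A u *\<^sub>R h u) \<partial>lborel) < \<infinity>"
        then have "integrable lborel (\<lambda>u. indicator A u *\<^sub>R h u)"
          by (intro integrableI_nonneg meas) (auto simp: pos split: split_indicator)
        with False iff show False by simp
      qed
      with False show ?thesis
        unfolding ind infinity_ennreal_def by (metis top.not_eq_extremum)
    qed
  qed
  have "S \<in> sets lebesgue" using S by simp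
  note cov = has_absolute_integral_change_of_variables_1'[OF this der inj, of f, folded g_def]
  have "f absolutely_integrable_on \<phi> ` S \<longleftrightarrow> g absolutely_integrable_on S"
    using cov by blast
  moreover have "integral (\<phi> ` S) f = integral S g" if "g absolutely_integrable_on S"
    using cov[of "integral S g"] that by blast
  ultimately have "(\<integral>\<^sup>+u\<in>\<phi> ` S. ennreal (f u) \<partial>lborel) = (\<integral>\<^sup>+x\<in>S. ennreal (g x) \<partial>lborel)"
    using key[OF img, of f] key[OF S, of g] g_nonneg nonneg by fastforce
  then show ?thesis
    by (simp only: g_def)
qed

text \<open>
  The left inverse \<open>\<psi>\<close> is part of the data because it yields both the injectivity of \<open>\<phi>\<close> and the
  Borel measurability of the images of Borel sets; images under a Borel function alone need not be
  Borel.
\<close>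

definition inverse_branch ::
  "real set \<Rightarrow> (real \<Rightarrow> real) \<Rightarrow> (real \<Rightarrow> real) \<Rightarrow> (real \<Rightarrow> real) \<Rightarrow> bool" where
  "inverse_branch I \<phi> \<phi>' \<psi> \<longleftrightarrow>
     is_interval I \<and>
     \<phi> \<in> borel_measurable borel \<and> \<phi>' \<in> borel_measurable borel \<and> \<psi> \<in> borel_measurable borel \<and>
     (\<forall>w\<in>I. (\<phi> has_field_derivative \<phi>' w) (at w) \<and> \<psi> (\<phi> w) = w)"

text \<open>
  Since \<open>\<phi>\<close> is continuous, it maps the interval \<open>I\<close> to an interval, and within that interval the
  image of \<open>B\<close> is the preimage of \<open>B\<close> under \<open>\<psi>\<close>.
\<close>

lemma inverse_branch_image_borel:
  assumes br: "inverse_branch I \<phi> \<phi>' \<psi>" and B: "B \<in> sets borel"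
  shows "\<phi> ` (I \<inter> B) \<in> sets borel"
proof -
  have "continuous_on I \<phi>"
    using br unfolding inverse_branch_def
    by (auto intro!: continuous_at_imp_continuous_on DERIV_isCont)
  then have "is_interval (\<phi> ` I)"
    using br unfolding inverse_branch_def is_interval_connected_1
    by (intro connected_continuous_image) auto
  then have "\<phi> ` I \<in> sets borel"
    by (rule real_interval_borel_measurable)
  moreover have "\<psi> -` B \<in> sets borel"
    using br B measurable_sets[of \<psi> borel borel B] unfolding inverse_branch_def by simp
  moreover have "\<phi> ` (I \<inter> B) = \<phi> ` I \<inter> \<psi> -` B"
    using br by (auto simp: inverse_branch_def)
  ultimately show ?thesis by simp
qed

lemma inverse_branch_integral:
  assumes br: "inverse_branch I \<phi> \<phi>' \<psi>" and B: "B \<in> sets borel"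
    and f: "f \<in> borel_measurable borel" and nonneg: "\<And>w. w \<in> I \<Longrightarrow> 0 \<le> f (\<phi> w)"
  shows "(\<integral>\<^sup>+u\<in>\<phi> ` (I \<inter> B). ennreal (f u) \<partial>lborel) =
         (\<integral>\<^sup>+w\<in>I \<inter> B. ennreal (\<bar>\<phi>' w\<bar> * f (\<phi> w)) \<partial>lborel)"
proof (rule nn_integral_change_of_variables)
  show "I \<inter> B \<in> sets borel"
    using br B real_interval_borel_measurable unfolding inverse_branch_def by blast
  show "inj_on \<phi> (I \<inter> B)"
    using br by (intro inj_on_inverseI[of _ \<psi>]) (simp add: inverse_branch_def)
  show "(\<phi> has_field_derivative \<phi>' x) (at x within I \<inter> B)" if "x \<in> I \<inter> B" for x
    using br that by (auto simp: inverse_branch_def intro: has_field_derivative_at_within)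
  show "\<phi> \<in> borel_measurable borel" "\<phi>' \<in> borel_measurable borel"
    using br by (simp_all add: inverse_branch_def)
qed (use f nonneg inverse_branch_image_borel[OF br B] in simp_all)

text \<open>
  The sum \<open>k\<close> is the value at \<open>f\<close> of the transfer operator of the map that the functions \<open>\<phi> n\<close>
  invert.
\<close>

lemma inverse_branches_integral:
  assumes br: "\<And>n::nat. inverse_branch I (\<phi> n) (\<phi>' n) (\<psi> n)" and B: "B \<in> sets borel"
    and disj: "disjoint_family (\<lambda>n. \<phi> n ` I)"
    and f: "f \<in> borel_measurable borel" and nonneg: "\<And>n w. w \<in> I \<Longrightarrow> 0 \<le> f (\<phi> n w)"
    and k: "\<And>w. w \<in> I \<Longrightarrow> (\<lambda>n. \<bar>\<phi>' n w\<bar> * f (\<phi> n w)) sums k w"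
  shows "(\<integral>\<^sup>+u\<in>(\<Union>n. \<phi> n ` (I \<inter> B)). ennreal (f u) \<partial>lborel) = (\<integral>\<^sup>+w\<in>I \<inter> B. ennreal (k w) \<partial>lborel)"
proof -
  have IB [measurable]: "I \<inter> B \<in> sets borel"
    using br[of 0] B real_interval_borel_measurable unfolding inverse_branch_def by blast
  have [measurable]: "\<phi> n \<in> borel_measurable borel" "\<phi>' n \<in> borel_measurable borel"
    "f \<in> borel_measurable borel" for n
    using br f unfolding inverse_branch_def by auto
  have "(\<integral>\<^sup>+u\<in>(\<Union>n. \<phi> n ` (I \<inter> B)). ennreal (f u) \<partial>lborel) =
      (\<Sum>n. \<integral>\<^sup>+u\<in>\<phi> n ` (I \<inter> B). ennreal (f u) \<partial>lborel)"
  proof (rule nn_integral_disjoint_family)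
    show "disjoint_family (\<lambda>n. \<phi> n ` (I \<inter> B))"
      using disj by (rule disjoint_family_on_bisimulation) auto
  qed (use inverse_branch_image_borel[OF br B] in auto)
  also have "\<dots> = (\<Sum>n. \<integral>\<^sup>+w. ennreal (\<bar>\<phi>' n w\<bar> * f (\<phi> n w)) * indicator (I \<inter> B) w \<partial>lborel)"
    by (simp only: inverse_branch_integral[OF br B f nonneg])
  also have "\<dots> = (\<integral>\<^sup>+w. (\<Sum>n. ennreal (\<bar>\<phi>' n w\<bar> * f (\<phi> n w)) * indicator (I \<inter> B) w) \<partial>lborel)"
    by (rule nn_integral_suminf[symmetric]) measurable
  also have "\<dots> = (\<integral>\<^sup>+w\<in>I \<inter> B. ennreal (k w) \<partial>lborel)"
  proof (rule nn_integral_cong)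
    fix w
    show "(\<Sum>n. ennreal (\<bar>\<phi>' n w\<bar> * f (\<phi> n w)) * indicator (I \<inter> B) w) =
        ennreal (k w) * indicator (I \<inter> B) w"
    proof (cases "w \<in> I \<inter> B")
      case True
      then have "(\<Sum>n. ennreal (\<bar>\<phi>' n w\<bar> * f (\<phi> n w))) = ennreal (k w)"
        by (intro suminf_ennreal_eq k) (simp_all add: nonneg)
      with True show ?thesis by simp
    qed simp
  qed
  finally show ?thesis .
qed

section \<open>Sectors as intervals\<close>

text \<open>
  All numbers that occur are rational expressions in the silver ratio, which the quadratic equation
  \<open>silver_squared\<close> reduces to linear ones.
\<close>

definition silver :: real where "silver = 1 + sqrt 2"

lemma silver_squared: "silver * silver = 2 * silver + 1"
  by (simp add: silver_def algebra_simps)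

lemma silver_bounds: "2 < silver" "silver < 3"
  by (simp_all add: silver_def real_less_lsqrt)

lemma arctan_silver_minus_2: "arctan (silver - 2) = pi / 8"
proof -
  have "\<bar>silver - 2\<bar> < 1" using silver_bounds by simp
  then have "2 * arctan (silver - 2) = arctan (2 * (silver - 2) / (1 - (silver - 2)\<^sup>2))"
    by (rule arctan_double)
  also have "1 - (silver - 2)\<^sup>2 = 2 * (silver - 2)"
    using silver_squared by (simp add: power2_eq_square algebra_simps)
  also have "2 * (silver - 2) / (2 * (silver - 2)) = 1"
    using silver_bounds by simp
  finally show ?thesis by (simp add: arctan_one)
qed

lemma arctan_silver: "arctan silver = 3 * pi / 8"
proof -
  have "inverse (silver - 2) = silver"
    using silver_squared by (intro inverse_unique) (simp add: algebra_simps)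
  moreover have "arctan (inverse (silver - 2)) = pi / 2 - arctan (silver - 2)"
    using silver_bounds by (intro Complex_Transcendental.arctan_inverse) simp
  ultimately show ?thesis by (simp add: arctan_silver_minus_2)
qed

text \<open>
  Angles are compared through \<open>arctan\<close>, which is monotone on the whole line.
\<close>

lemma cot_eq_iff_arctan:
  assumes "\<theta> \<in> {0<..<pi}"
  shows "cot \<theta> = u \<longleftrightarrow> arctan u = pi / 2 - \<theta>"
proof -
  have c: "cot \<theta> = tan (pi / 2 - \<theta>)"
    by (simp add: tan_def cot_def sin_diff cos_diff)
  have "arctan (tan (pi / 2 - \<theta>)) = pi / 2 - \<theta>"
    using assms by (intro arctan_tan) auto
  then show ?thesis by (metis c tan_arctan)
qed

lemma rp1_of_angle_eq_Finite_iff: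
  assumes "\<theta> \<in> {0..<pi}"
  shows "rp1_of_angle \<theta> = Finite u \<longleftrightarrow> arctan u = pi / 2 - \<theta>"
proof (cases "\<theta> = 0")
  case True
  then show ?thesis using arctan_ubound[of u] by (simp add: rp1_of_angle_def)
next
  case False
  with assms have "sin \<theta> > 0" by (intro sin_gt_zero) auto
  with False assms show ?thesis
    by (simp add: rp1_of_angle_def cot_eq_iff_arctan)
qed

lemma Finite_in_sector_iff:
  assumes "i \<in> {1..7}"
  shows "Finite u \<in> sector i \<longleftrightarrow>
    pi / 2 - real (i + 1) * pi / 8 < arctan u \<and> arctan u \<le> pi / 2 - real i * pi / 8"
proof -
  have "0 \<le> real i * pi" and "real (i + 1) * pi \<le> 8 * pi"
    using assms by (auto intro!: mult_right_mono)
  then have sub: "{real i * pi / 8 ..< real (i + 1) * pi / 8} \<subseteq> {0..<pi}"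
    by (intro subsetI) (simp only: atLeastLessThan_iff, linarith)
  have "Finite u \<in> sector i \<longleftrightarrow>
      (\<exists>\<theta>\<in>{real i * pi / 8 ..< real (i + 1) * pi / 8}. rp1_of_angle \<theta> = Finite u)"
    unfolding sector_def by (metis (no_types, lifting) image_iff)
  also have "\<dots> \<longleftrightarrow>
      (\<exists>\<theta>\<in>{real i * pi / 8 ..< real (i + 1) * pi / 8}. arctan u = pi / 2 - \<theta>)"
    by (intro bex_cong refl rp1_of_angle_eq_Finite_iff; erule subsetD[OF sub])
  also have "\<dots> \<longleftrightarrow> pi / 2 - arctan u \<in> {real i * pi / 8 ..< real (i + 1) * pi / 8}"
  proof -
    have "arctan u = pi / 2 - \<theta> \<longleftrightarrow> \<theta> = pi / 2 - arctan u" for \<theta> by linarith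
    then show ?thesis by simp
  qed
  finally show ?thesis by auto
qed

lemma Infinity_notin_sector:
  assumes "i \<in> {1..7}"
  shows "Infinity \<notin> sector i"
proof
  assume "Infinity \<in> sector i"
  then obtain \<theta> where \<theta>: "real i * pi / 8 \<le> \<theta>" "\<theta> < real (i + 1) * pi / 8" "rp1_of_angle \<theta> = Infinity"
    unfolding sector_def by auto
  have "1 * pi \<le> real i * pi" "real (i + 1) * pi \<le> 8 * pi"
    using assms by (auto intro!: mult_right_mono)
  with \<theta> pi_gt_zero have "0 < \<theta>" "\<theta> < pi" by linarith+
  then have "sin \<theta> > 0" by (intro sin_gt_zero)
  with \<theta>(3) show False by (simp add: rp1_of_angle_def)
qed

lemma sector_unique:
  assumes "i \<in> {1..7}" "j \<in> {1..7}" "p \<in> sector i" "p \<in> sector j"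
  shows "i = j"
proof -
  obtain u where u: "p = Finite u"
    using assms Infinity_notin_sector by (cases p) auto
  have "pi / 2 - real (i + 1) * pi / 8 < pi / 2 - real j * pi / 8"
    "pi / 2 - real (j + 1) * pi / 8 < pi / 2 - real i * pi / 8"
    using assms(3,4) unfolding u Finite_in_sector_iff[OF assms(1)] Finite_in_sector_iff[OF assms(2)]
    by linarith+
  then have "real j * pi < real (i + 1) * pi" "real i * pi < real (j + 1) * pi"
    by linarith+
  then have "real j < real (i + 1)" "real i < real (j + 1)"
    by (simp_all only: mult_less_cancel_right_pos[OF pi_gt_zero])
  then show ?thesis by linarith
qed

lemma sector_eq_image:
  assumes i: "i \<in> {1..7}" and A: "\<And>u. u \<in> A \<longleftrightarrow>
    pi / 2 - real (i + 1) * pi / 8 < arctan u \<and> arctan u \<le> pi / 2 - real i * pi / 8"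
  shows "sector i = Finite ` A"
proof (rule set_eqI)
  fix p show "p \<in> sector i \<longleftrightarrow> p \<in> Finite ` A"
    using Infinity_notin_sector[OF i] Finite_in_sector_iff[OF i] A by (cases p) auto
qed

lemma sector_eq_interval:
  assumes i: "i \<in> {1..7}"
    and a: "arctan a = pi / 2 - real (i + 1) * pi / 8" and b: "arctan b = pi / 2 - real i * pi / 8"
  shows "sector i = Finite ` {a<..b}"
  by (rule sector_eq_image[OF i])
    (simp only: a[symmetric] b[symmetric] arctan_less_iff arctan_le_iff greaterThanAtMost_iff)

text \<open>
  The endpoints are the cotangents of the multiples of \<open>\<pi> / 8\<close>; since \<open>1 / silver = silver - 2\<close>,
  they are \<open>\<plusminus>silver\<close>, \<open>\<plusminus>1\<close>, \<open>\<plusminus>1 / silver\<close> and \<open>0\<close>. The last sector is unbounded because its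
  angles end at \<open>\<pi>\<close>.
\<close>

lemma sector_eqs:
  "sector 1 = Finite ` {1<..silver}"
  "sector 2 = Finite ` {silver - 2<..1}"
  "sector 3 = Finite ` {0<..silver - 2}"
  "sector 4 = Finite ` {2 - silver<..0}"
  "sector 5 = Finite ` {-1<..2 - silver}"
  "sector 6 = Finite ` {-silver<..-1}"
  "sector 7 = Finite ` {..-silver}"
proof -
  have neg: "arctan (2 - silver) = - (pi / 8)" "arctan (- silver) = - (3 * pi / 8)"
    "arctan (- 1) = - (pi / 4)"
    using arctan_minus[of "silver - 2"] arctan_minus[of silver] arctan_minus[of 1]
    by (simp_all only: arctan_silver_minus_2 arctan_silver arctan_one minus_diff_eq)
  note arcs = neg arctan_silver_minus_2 arctan_silver arctan_one arctan_zero_zero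
  show "sector 1 = Finite ` {1<..silver}"
    by (rule sector_eq_interval; (simp only: arcs)?; simp)
  show "sector 2 = Finite ` {silver - 2<..1}"
    by (rule sector_eq_interval; (simp only: arcs)?; simp)
  show "sector 3 = Finite ` {0<..silver - 2}"
    by (rule sector_eq_interval; (simp only: arcs)?; simp)
  show "sector 4 = Finite ` {2 - silver<..0}"
    by (rule sector_eq_interval; (simp only: arcs)?; simp)
  show "sector 5 = Finite ` {-1<..2 - silver}"
    by (rule sector_eq_interval; (simp only: arcs)?; simp)
  show "sector 6 = Finite ` {-silver<..-1}"
    by (rule sector_eq_interval; (simp only: arcs)?; simp)
  show "sector 7 = Finite ` {..-silver}"
  proof (rule sector_eq_image)
    fix u
    have "u \<in> {..-silver} \<longleftrightarrow> arctan u \<le> - (3 * pi / 8)"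
      by (simp only: atMost_iff neg(2)[symmetric] arctan_le_iff)
    then show "u \<in> {..-silver} \<longleftrightarrow> pi / 2 - real (7 + 1) * pi / 8 < arctan u \<and>
        arctan u \<le> pi / 2 - real 7 * pi / 8"
      using arctan_lbound[of u] by auto
  qed simp
qed

\<comment> \<open>The simplifier rewrites the index \<open>1\<close> to \<open>Suc 0\<close>.\<close>
lemmas sector_eq = sector_eqs sector_eqs(1)[unfolded One_nat_def]

lemma Sigma_oct_eq: "Sigma_oct = Finite ` {..silver}"
proof -
  have I: "{1..7} = {1,2,3,4,5,6,7::nat}" by auto
  have "Sigma_oct = Finite ` ({1<..silver} \<union> {silver - 2<..1} \<union> {0<..silver - 2} \<union>
    {2 - silver<..0} \<union> {-1<..2 - silver} \<union> {-silver<..-1} \<union> {..-silver})"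
    unfolding Sigma_oct_def I by (simp add: sector_eq image_Un Un_assoc)
  also have "{1<..silver} \<union> {silver - 2<..1} \<union> {0<..silver - 2} \<union>
    {2 - silver<..0} \<union> {-1<..2 - silver} \<union> {-silver<..-1} \<union> {..-silver} = {..silver}"
    using silver_bounds
    by (intro set_eqI; simp only: Un_iff greaterThanAtMost_iff atMost_iff) linarith
  finally show ?thesis .
qed

section \<open>The Farey map and the Gauss map\<close>

lemma farey_in_sector:
  assumes "i \<in> {1..7}" "p \<in> sector i"
  shows "farey p = moebius (gamma_mat ** nu_mat i) p"
proof -
  have "(THE j. j \<in> {1..7} \<and> p \<in> sector j) = i"
    using assms sector_unique by (intro the_equality) blast+
  with assms show ?thesis by (auto simp: farey_def Sigma_oct_def)
qed

text \<open>
  The scalar \<open>k\<close> absorbs the normalization \<open>1 / \<surd>2\<close> of four of the matrices: proportional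
  matrices define the same Moebius map.
\<close>

lemma moebius_gamma_mult:
  assumes "k \<noteq> 0"
  shows "moebius (gamma_mat ** (k *\<^sub>R mat2 a b c d)) (Finite u) =
    (if c * u + d = 0 then Infinity else Finite (2 * silver - (a * u + b) / (c * u + d)))"
proof -
  have 1: "k * c * u + k * d = k * (c * u + d)" by (simp add: algebra_simps)
  have "moebius (gamma_mat ** (k *\<^sub>R mat2 a b c d)) (Finite u) =
    (if k * (c * u + d) = 0 then Infinity
     else Finite ((2 * silver * (k * (c * u + d)) - k * (a * u + b)) / (k * (c * u + d))))"
    by (simp add: moebius_def Let_def gamma_mat_def silver_def mat2_def matrix_matrix_mult_def sum_2 1[symmetric])
      (simp add: silver_def algebra_simps)
  also have "\<dots> = (if c * u + d = 0 then Infinity else Finite (2 * silver - (a * u + b) / (c * u + d)))"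
    using assms by (auto simp: diff_divide_distrib)
  finally show ?thesis .
qed

lemma farey_parabolic_1:
  assumes "1 < u" "u \<le> silver"
  shows "farey (Finite u) = Finite (2 * silver - (u + 1) / (u - 1))"
proof -
  have "Finite u \<in> sector 1" using assms by (simp add: sector_eq)
  then show ?thesis
    using assms moebius_gamma_mult[of "1 / sqrt 2" 1 1 1 "-1" u]
    by (simp add: farey_in_sector[of 1] nu_mat_def)
qed

lemma farey_parabolic_7:
  assumes "u \<le> - silver"
  shows "farey (Finite u) = Finite (u + 2 * silver)"
proof -
  have "Finite u \<in> sector 7" using assms by (simp add: sector_eq)
  then show ?thesis
    using assms moebius_gamma_mult[of "1" "-1" 0 0 "1" u]
    by (simp add: farey_in_sector[of 7] nu_mat_def)
qed

text \<open>
  If \<open>x 0\<close> lies outside a parabolic sector and its successive preimages \<open>x 1, x 2, \<dots>\<close> all lie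
  inside, then the point \<open>x n\<close> with \<open>n \<ge> 1\<close> leaves the sector after exactly \<open>n\<close>
  steps. Working with backward orbits, that is, with inverse
  branches, avoids computing the exit time of a given point.
\<close>

lemma gauss_backward_orbit:
  assumes k: "k = 1 \<or> k = 7" and out: "x 0 \<notin> sector k"
    and inside: "\<And>n. x (Suc n) \<in> sector k" and step: "\<And>n. farey (x (Suc n)) = x n"
  shows "gauss (x (Suc n)) = x 0"
proof -
  have orbit: "(farey ^^ m) (x n) = x (n - m)" if "m \<le> n" for m n
    using that
  proof (induction m)
    case (Suc m)
    then have "n - m = Suc (n - Suc m)" by simp
    with Suc step show ?case by simp
  qed simp
  have "exit_time k (x (Suc n)) = Suc n"
    unfolding exit_time_def
  proof (rule Least_equality)
    show "(farey ^^ Suc n) (x (Suc n)) \<notin> sector k"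
      using orbit[of "Suc n" "Suc n"] out by simp
  next
    fix m assume m: "(farey ^^ m) (x (Suc n)) \<notin> sector k"
    show "Suc n \<le> m"
    proof (rule ccontr)
      assume "\<not> Suc n \<le> m"
      then have "(farey ^^ m) (x (Suc n)) = x (Suc (n - m))"
        using orbit[of m "Suc n"] by (simp add: Suc_diff_le)
      with m inside show False by simp
    qed
  qed
  moreover have "x (Suc n) \<in> sector 7 \<Longrightarrow> x (Suc n) \<notin> sector 1"
    using sector_unique[of 1 7] by auto
  ultimately show ?thesis
    using k inside[of n] orbit[of "Suc n" "Suc n"] by (auto simp: gauss_def simp del: funpow.simps)
qed

section \<open>The measure\<close>

lemma inj_Finite: "inj Finite"
  by (simp add: inj_on_def)

text \<open>
  The angle \<open>7 \<pi> / 8\<close> is the point \<open>- silver\<close>, and \<open>\<gamma>[- silver] = silver + 2 silver\<close>.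
\<close>

lemma cot_gamma_7pi8: "cot (angle_action gamma_mat (7 * pi / 8)) = 3 * silver"
proof -
  define \<phi> where "\<phi> = angle_action gamma_mat (7 * pi / 8)"
  have "rp1_of_angle (7 * pi / 8) = Finite (- silver)"
    by (subst rp1_of_angle_eq_Finite_iff)
      (simp_all only: arctan_minus arctan_silver atLeastLessThan_iff, simp_all)
  then have im: "moebius gamma_mat (rp1_of_angle (7 * pi / 8)) = Finite (3 * silver)"
    by (simp add: moebius_def gamma_mat_def silver_def mat2_def Let_def)
  have "\<exists>!\<phi>. \<phi> \<in> {0..<pi} \<and> rp1_of_angle \<phi> = Finite (3 * silver)"
  proof (rule ex_ex1I)
    show "\<exists>\<phi>. \<phi> \<in> {0..<pi} \<and> rp1_of_angle \<phi> = Finite (3 * silver)"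
    proof (intro exI conjI)
      show *: "pi / 2 - arctan (3 * silver) \<in> {0..<pi}"
        using arctan_ubound[of "3 * silver"] arctan_lbound[of "3 * silver"]
        unfolding atLeastLessThan_iff by linarith
      show "rp1_of_angle (pi / 2 - arctan (3 * silver)) = Finite (3 * silver)"
        unfolding rp1_of_angle_eq_Finite_iff[OF *] by linarith
    qed
  next
    fix \<phi> \<phi>'
    assume "\<phi> \<in> {0..<pi} \<and> rp1_of_angle \<phi> = Finite (3 * silver)"
      "\<phi>' \<in> {0..<pi} \<and> rp1_of_angle \<phi>' = Finite (3 * silver)"
    then have "arctan (3 * silver) = pi / 2 - \<phi>" "arctan (3 * silver) = pi / 2 - \<phi>'"
      using rp1_of_angle_eq_Finite_iff by blast+
    then show "\<phi> = \<phi>'" by linarith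
  qed
  then have "\<phi> \<in> {0..<pi} \<and> rp1_of_angle \<phi> = Finite (3 * silver)"
    unfolding \<phi>_def angle_action_def im by (rule theI')
  then show ?thesis
    unfolding \<phi>_def[symmetric] by (auto simp: rp1_of_angle_def split: if_splits)
qed

lemma gauss_density_eqs:
  "u \<le> - silver \<Longrightarrow> gauss_density u = 1 / (silver - u) - 1 / (3 * silver - u)"
  "- silver < u \<Longrightarrow> u \<le> 1 \<Longrightarrow> gauss_density u = 1 / (silver - u)"
  "1 < u \<Longrightarrow> gauss_density u = 1 / (2 * silver - 1 - u)"
proof -
  have dens: "gauss_density u = (if u \<le> - silver then 1 / (u - 3 * silver) + 1 / (silver - u)
      else if u \<le> 1 then 1 / (silver - u) else 1 / (2 * silver - 1 - u))"
    by (simp add: gauss_density_def cot_gamma_7pi8 silver_def)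
  have "1 / (u - 3 * silver) = - (1 / (3 * silver - u))"
    by (metis minus_diff_eq minus_divide_right)
  then show "u \<le> - silver \<Longrightarrow> gauss_density u = 1 / (silver - u) - 1 / (3 * silver - u)"
    by (simp add: dens)
  show "- silver < u \<Longrightarrow> u \<le> 1 \<Longrightarrow> gauss_density u = 1 / (silver - u)"
    by (simp add: dens)
  show "1 < u \<Longrightarrow> gauss_density u = 1 / (2 * silver - 1 - u)"
    using silver_bounds by (simp add: dens)
qed

lemma gauss_density_nonneg:
  assumes "u \<le> silver"
  shows "0 \<le> gauss_density u"
proof -
  have "1 / (3 * silver - u) \<le> 1 / (silver - u)" if "u \<le> - silver"
    using that silver_bounds by (intro frac_le) linarith+
  moreover have "0 \<le> 1 / (silver - u)" "0 \<le> 1 / (2 * silver - 1 - u)"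
    using assms silver_bounds by (intro divide_nonneg_nonneg; linarith)+
  ultimately show ?thesis
    using gauss_density_eqs[of u] by linarith
qed

lemma gauss_density_borel [measurable]: "gauss_density \<in> borel_measurable borel"
  unfolding gauss_density_def cot_gamma_7pi8 by measurable

lemma sets_mu_gauss:
  "sets mu_gauss = {Finite ` A | A. A \<in> sets borel \<and> A \<subseteq> {..silver}}"
proof -
  have "A \<in> sets (restrict_space lborel {..silver}) \<longleftrightarrow> A \<in> sets borel \<and> A \<subseteq> {..silver}" for A
    by (subst sets_restrict_space_iff) auto
  then show ?thesis
    unfolding mu_gauss_def Sigma_oct_eq inj_vimage_image_eq[OF inj_Finite]
      sets_embed_measure[OF inj_Finite] sets_density by simp
qed

lemma emeasure_mu_gauss:
  assumes "A \<in> sets borel" "A \<subseteq> {..silver}"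
  shows "emeasure mu_gauss (Finite ` A) = (\<integral>\<^sup>+u\<in>A. ennreal (gauss_density u) \<partial>lborel)"
proof -
  have A: "A \<in> sets (restrict_space lborel {..silver})"
    using assms by (simp add: sets_restrict_space_iff)
  have [measurable]: "(\<lambda>u. ennreal (gauss_density u)) \<in> borel_measurable (restrict_space lborel {..silver})"
    by (intro measurable_restrict_space1) measurable
  have "emeasure mu_gauss (Finite ` A) =
      emeasure (density (restrict_space lborel {..silver}) (\<lambda>u. ennreal (gauss_density u))) A"
    unfolding mu_gauss_def Sigma_oct_eq inj_vimage_image_eq[OF inj_Finite]
    by (rule emeasure_embed_measure_image[OF inj_Finite]) (simp add: A)
  also have "\<dots> = (\<integral>\<^sup>+u\<in>A. ennreal (gauss_density u) \<partial>restrict_space lborel {..silver})"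
    using A by (rule emeasure_density[rotated]) measurable
  also have "\<dots> = (\<integral>\<^sup>+u\<in>A. ennreal (gauss_density u) \<partial>lborel)"
    using assms(2) by (subst nn_integral_restrict_space)
      (auto intro!: nn_integral_cong split: split_indicator)
  finally show ?thesis .
qed

section \<open>Branches with values in the middle sectors\<close>

lemma silver_quotients:
  "1 / silver = silver - 2" "2 / (silver + 1) = 3 - silver" "2 / (1 + silver) = 3 - silver"
  "2 / (silver - 1) = silver - 1"
  using silver_squared silver_bounds
  by (subst nonzero_divide_eq_eq; simp add: algebra_simps)+

text \<open>
  For \<open>2 \<le> i \<le> 6\<close> the matrix \<open>\<nu>\<^sub>i\<close> acts as \<open>u \<mapsto> q / (u - p) - r\<close>, where \<open>p\<close>, \<open>q\<close>, \<open>r\<close> are the pole,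
  residue and shift of index \<open>i\<close>, so that \<open>\<gamma> \<nu>\<^sub>i\<close> is \<open>u \<mapsto> 2 silver + r - q / (u - p)\<close>. The
  function \<open>middle_branch i\<close> inverts it; \<open>middle_inverse i\<close> is the map itself.
\<close>

definition middle_pole :: "nat \<Rightarrow> real" where
  "middle_pole i = (if i = 2 then 1 else if i \<le> 4 then 0 else - 1)"

definition middle_residue :: "nat \<Rightarrow> real" where
  "middle_residue i = (if i = 3 then 1 else if i = 4 then - 1 else if i = 5 then 2 else - 2)"

definition middle_shift :: "nat \<Rightarrow> real" where
  "middle_shift i = (if i = 2 \<or> i = 5 then 1 else if i = 6 then - 1 else 0)"

definition middle_branch :: "nat \<Rightarrow> real \<Rightarrow> real" where
  "middle_branch i w = middle_pole i + middle_residue i / (2 * silver - w + middle_shift i)"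

definition middle_inverse :: "nat \<Rightarrow> real \<Rightarrow> real" where
  "middle_inverse i u = 2 * silver + middle_shift i - middle_residue i / (u - middle_pole i)"

definition middle_deriv :: "nat \<Rightarrow> real \<Rightarrow> real" where
  "middle_deriv i w = middle_residue i / (2 * silver - w + middle_shift i)\<^sup>2"

lemmas middle_defs = middle_pole_def middle_residue_def middle_shift_def

lemma middle_index_cases:
  fixes i :: nat
  assumes "i \<in> {2..6}"
  obtains "i = 2" | "i = 3" | "i = 4" | "i = 5" | "i = 6"
  using assms by fastforce

lemma middle_residue_nonzero: "middle_residue i \<noteq> 0"
  by (simp add: middle_residue_def)

lemma middle_denominator_pos:
  assumes "w < silver"
  shows "0 < 2 * silver - w + middle_shift i"
  using assms silver_bounds by (simp add: middle_shift_def)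

lemma farey_middle:
  assumes i: "i \<in> {2..6}" and u: "Finite u \<in> sector i" "u \<noteq> middle_pole i"
  shows "farey (Finite u) = Finite (middle_inverse i u)"
proof -
  have "i \<in> {1..7}" using i by auto
  note F = farey_in_sector[OF this u(1)]
  from i show ?thesis
  proof (cases rule: middle_index_cases)
    case 1
    then show ?thesis using F u(2) moebius_gamma_mult[of "1 / sqrt 2" 1 1 "-1" 1 u]
      by (simp add: nu_mat_def middle_inverse_def middle_defs) (simp add: field_simps)
  next
    case 2
    then show ?thesis using F u(2) moebius_gamma_mult[of 1 0 1 1 0 u]
      by (simp add: nu_mat_def middle_inverse_def middle_defs)
  next
    case 3
    then show ?thesis using F u(2) moebius_gamma_mult[of 1 0 1 "-1" 0 u]
      by (simp add: nu_mat_def middle_inverse_def middle_defs)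
  next
    case 4
    then show ?thesis using F u(2) moebius_gamma_mult[of "1 / sqrt 2" "-1" 1 1 1 u]
      by (simp add: nu_mat_def middle_inverse_def middle_defs) (simp add: field_simps)
  next
    case 5
    then show ?thesis using F u(2) moebius_gamma_mult[of "1 / sqrt 2" "-1" 1 "-1" "-1" u]
      by (simp add: nu_mat_def middle_inverse_def middle_defs) (simp add: field_simps)
  qed
qed

lemma middle_inverse_branch: "middle_inverse i (middle_branch i w) = w"
  using middle_residue_nonzero[of i] by (simp add: middle_inverse_def middle_branch_def)

text \<open>
  As \<open>w\<close> runs from \<open>-\<infinity>\<close> to \<open>a\<close>, the value \<open>q / (b - w)\<close> grows from \<open>0\<close> to \<open>q / (b - a)\<close>. The two
  parts serve branches of positive and negative residue.
\<close>

lemma hyperbola_image: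
  fixes p q a b :: real
  assumes "a < b" "q > 0"
  shows "(\<lambda>w. p + q / (b - w)) ` {..<a} = {p<..<p + q / (b - a)}"
    and "(\<lambda>w. p - q / (b - w)) ` {..<a} = {p - q / (b - a)<..<p}"
proof -
  have key: "(\<lambda>w. q / (b - w)) ` {..<a} = {0<..<q / (b - a)}"
  proof (intro equalityI subsetI)
    fix x assume "x \<in> (\<lambda>w. q / (b - w)) ` {..<a}"
    then show "x \<in> {0<..<q / (b - a)}"
      using assms by (auto intro!: divide_strict_left_mono)
  next
    fix x assume x: "x \<in> {0<..<q / (b - a)}"
    then have "x = q / (b - (b - q / x))" using assms by simp
    moreover have "b - q / x < a"
      using x assms by (simp add: field_simps)
    ultimately show "x \<in> (\<lambda>w. q / (b - w)) ` {..<a}" by blast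
  qed
  have "(\<lambda>w. p + q / (b - w)) ` {..<a} = (+) p ` {0<..<q / (b - a)}"
    unfolding key[symmetric] image_image ..
  also have "\<dots> = {p<..<p + q / (b - a)}"
    by (force simp: image_iff intro: bexI[of _ "_ - p"])
  finally show "(\<lambda>w. p + q / (b - w)) ` {..<a} = {p<..<p + q / (b - a)}" .
  have "(\<lambda>w. p - q / (b - w)) ` {..<a} = (-) p ` {0<..<q / (b - a)}"
    unfolding key[symmetric] image_image ..
  also have "\<dots> = {p - q / (b - a)<..<p}"
    by (force simp: image_iff intro: bexI[of _ "p - _"])
  finally show "(\<lambda>w. p - q / (b - w)) ` {..<a} = {p - q / (b - a)<..<p}" .
qed

text \<open>
  The images are the open sectors: the endpoint of a sector that maps to \<open>silver\<close> or \<open>\<infinity>\<close> is left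
  out.
\<close>

lemma middle_branch_image:
  "middle_branch 2 ` {..<silver} = {silver - 2<..<1}"
  "middle_branch 3 ` {..<silver} = {0<..<silver - 2}"
  "middle_branch 4 ` {..<silver} = {2 - silver<..<0}"
  "middle_branch 5 ` {..<silver} = {-1<..<2 - silver}"
  "middle_branch 6 ` {..<silver} = {-silver<..<-1}"
  using hyperbola_image(2)[of silver "2 * silver + 1" 2 1]
    hyperbola_image(1)[of silver "2 * silver" 1 0]
    hyperbola_image(2)[of silver "2 * silver" 1 0]
    hyperbola_image(1)[of silver "2 * silver + 1" 2 "-1"]
    hyperbola_image(2)[of silver "2 * silver - 1" 2 "-1"] silver_bounds
  by (simp_all add: middle_branch_def[abs_def] middle_defs silver_quotients algebra_simps)

lemma middle_branch_in_sector:
  assumes "i \<in> {2..6}" "w < silver"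
  shows "Finite (middle_branch i w) \<in> sector i"
    and "middle_branch i w \<noteq> middle_pole i"
    and "- silver < middle_branch i w" and "middle_branch i w < 1"
proof -
  have *: "middle_branch i w \<in> middle_branch i ` {..<silver}"
    using assms(2) by auto
  obtain l r where lr: "middle_branch i ` {..<silver} = {l<..<r}" "Finite ` {l<..r} = sector i"
    "- silver \<le> l" "r \<le> 1"
    using assms(1)
  proof (cases rule: middle_index_cases)
    case 1
    with that[of "silver - 2" 1] show ?thesis
      using silver_bounds by (simp add: middle_branch_image sector_eq)
  next
    case 2
    with that[of 0 "silver - 2"] show ?thesis
      using silver_bounds by (simp add: middle_branch_image sector_eq)
  next
    case 3
    with that[of "2 - silver" 0] show ?thesis
      using silver_bounds by (simp add: middle_branch_image sector_eq)
  next
    case 4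
    with that[of "- 1" "2 - silver"] show ?thesis
      using silver_bounds by (simp add: middle_branch_image sector_eq)
  next
    case 5
    with that[of "- silver" "- 1"] show ?thesis
      using silver_bounds by (simp add: middle_branch_image sector_eq)
  qed
  have "l < middle_branch i w" "middle_branch i w < r"
    using * unfolding lr(1) by simp_all
  then have "Finite (middle_branch i w) \<in> sector i \<and> - silver < middle_branch i w \<and> middle_branch i w < 1"
    unfolding lr(2)[symmetric] using lr(3,4) by simp
  then show "Finite (middle_branch i w) \<in> sector i"
    "- silver < middle_branch i w" "middle_branch i w < 1" by simp_all
  show "middle_branch i w \<noteq> middle_pole i"
    using middle_residue_nonzero[of i] middle_denominator_pos[OF assms(2), of i]
    by (simp add: middle_branch_def)
qed

lemma gauss_middle_branch:
  assumes "i \<in> {2..6}" "w < silver"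
  shows "gauss (Finite (middle_branch i w)) = Finite w"
proof -
  note s = middle_branch_in_sector[OF assms]
  have "Finite (middle_branch i w) \<notin> sector 1" "Finite (middle_branch i w) \<notin> sector 7"
    using sector_unique[of 1 i] sector_unique[of 7 i] s(1) assms(1) by auto
  then show ?thesis
    using farey_middle[OF assms(1) s(1,2)] by (simp add: gauss_def middle_inverse_branch)
qed

lemma inverse_branch_middle:
  "inverse_branch {..<silver} (middle_branch i) (middle_deriv i) (middle_inverse i)"
  unfolding inverse_branch_def
proof (intro conjI ballI)
  show "is_interval {..<silver}" by (simp add: is_interval_1)
  show "middle_branch i \<in> borel_measurable borel"
    unfolding middle_branch_def[abs_def] by measurable
  show "middle_deriv i \<in> borel_measurable borel"
    unfolding middle_deriv_def[abs_def] by measurable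
  show "middle_inverse i \<in> borel_measurable borel"
    unfolding middle_inverse_def[abs_def] by measurable
  fix w assume "w \<in> {..<silver}"
  then have "2 * silver - w + middle_shift i \<noteq> 0"
    using middle_denominator_pos[of w i] by simp
  then show "(middle_branch i has_real_derivative middle_deriv i w) (at w)"
    unfolding middle_branch_def[abs_def] middle_deriv_def
    by (auto intro!: derivative_eq_intros simp: power2_eq_square)
  show "middle_inverse i (middle_branch i w) = w" by (rule middle_inverse_branch)
qed

text \<open>
  The middle sectors carry the density \<open>\<integral> dv / (u - v)\<^sup>2\<close> over \<open>[silver, \<infinity>]\<close>. Here \<open>z - e\<close> and \<open>z\<close>
  are the distances from \<open>w\<close> to the images of \<open>silver\<close> and \<open>\<infinity>\<close> under \<open>\<gamma> \<nu>\<^sub>i\<close>, so the right-hand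
  side is \<open>\<integral> dv / (w - v)\<^sup>2\<close> over the image of \<open>[silver, \<infinity>]\<close>; the sign of \<open>e\<close> tells in which
  order the two endpoints appear.
\<close>

lemma middle_weight:
  assumes i: "i \<in> {2..6}" and w: "w < silver"
    and p: "middle_pole i < silver" and e: "e = middle_residue i / (silver - middle_pole i)"
  defines "z \<equiv> 2 * silver - w + middle_shift i"
  shows "\<bar>middle_deriv i w\<bar> * gauss_density (middle_branch i w) = sgn e * (1 / (z - e) - 1 / z)"
proof -
  define c where "c = silver - middle_pole i"
  have c: "0 < c" using p by (simp add: c_def)
  have z: "0 < z" using middle_denominator_pos[OF w] by (simp add: z_def)
  note s = middle_branch_in_sector[OF i w]
  have r: "middle_residue i = c * e" using e c by (simp add: c_def)
  have b: "middle_branch i w = middle_pole i + c * e / z"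
    by (simp add: middle_branch_def r z_def)
  have m: "silver - middle_branch i w = c * (z - e) / z"
    using z by (simp add: b c_def field_simps)
  moreover have "0 < silver - middle_branch i w"
    using s silver_bounds by linarith
  ultimately have ze: "0 < z - e"
    using c z by (simp add: zero_less_mult_iff zero_less_divide_iff)
  have "\<bar>middle_deriv i w\<bar> * gauss_density (middle_branch i w) =
      c * \<bar>e\<bar> / z\<^sup>2 * (1 / (c * (z - e) / z))"
    using gauss_density_eqs(2)[of "middle_branch i w"] s(3,4) c
    by (simp add: middle_deriv_def r z_def[symmetric] abs_mult m)
  also have "\<dots> = \<bar>e\<bar> / (z * (z - e))"
    using c z ze by (simp add: power2_eq_square)
  also have "\<dots> = sgn e * (1 / (z - e) - 1 / z)"
    using z ze by (simp add: field_simps abs_sgn)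
  finally show ?thesis .
qed

text \<open>
  The intervals that belong to \<open>i = 6, 3, 4, 5, 2\<close>, in this order, are adjacent from left to
  right, so their reciprocals telescope.
\<close>

lemma middle_weights_sum:
  assumes w: "w < silver"
  shows "(\<Sum>i\<in>{2..6}. \<bar>middle_deriv i w\<bar> * gauss_density (middle_branch i w)) =
    1 / (2 * silver - 1 - w) - 1 / (3 * silver - w)"
proof -
  have I: "{2..6} = {2,3,4,5,6::nat}" by auto
  have "\<bar>middle_deriv 2 w\<bar> * gauss_density (middle_branch 2 w) =
      1 / (2 * silver - w + 1) - 1 / (3 * silver - w)"
    by (subst middle_weight[OF _ w _ refl])
      (use silver_bounds in \<open>simp_all add: middle_defs silver_quotients algebra_simps\<close>)
  moreover have "\<bar>middle_deriv 3 w\<bar> * gauss_density (middle_branch 3 w) =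
      1 / (2 * silver - w - (silver - 2)) - 1 / (2 * silver - w)"
    by (subst middle_weight[OF _ w _ refl])
      (use silver_bounds in \<open>simp_all add: middle_defs silver_quotients algebra_simps\<close>)
  moreover have "\<bar>middle_deriv 4 w\<bar> * gauss_density (middle_branch 4 w) =
      1 / (2 * silver - w) - 1 / (2 * silver - w + (silver - 2))"
    by (subst middle_weight[OF _ w _ refl])
      (use silver_bounds in \<open>simp_all add: middle_defs silver_quotients algebra_simps\<close>)
  moreover have "\<bar>middle_deriv 5 w\<bar> * gauss_density (middle_branch 5 w) =
      1 / (2 * silver - w + (silver - 2)) - 1 / (2 * silver - w + 1)"
    by (subst middle_weight[OF _ w _ refl])
      (use silver_bounds in \<open>simp_all add: middle_defs silver_quotients algebra_simps\<close>)
  moreover have "\<bar>middle_deriv 6 w\<bar> * gauss_density (middle_branch 6 w) =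
      1 / (2 * silver - 1 - w) - 1 / (2 * silver - w - (silver - 2))"
    by (subst middle_weight[OF _ w _ refl])
      (use silver_bounds in \<open>simp_all add: middle_defs silver_quotients algebra_simps\<close>)
  ultimately show ?thesis unfolding I by simp
qed

section \<open>Branches with values in the last sector\<close>

lemma telescoping_reciprocals_sums:
  fixes a b :: real
  assumes "0 < a"
  shows "(\<lambda>n. 1 / (b + a * real n) - 1 / (b + a * real (Suc n))) sums (1 / b)"
proof -
  have "filterlim (\<lambda>n. b + a * real n) at_top sequentially"
    by (intro filterlim_tendsto_add_at_top[OF tendsto_const]
        filterlim_tendsto_pos_mult_at_top[OF tendsto_const assms] filterlim_real_sequentially)
  then have "(\<lambda>n. 1 / (b + a * real n)) \<longlonglongrightarrow> 0"
    by (intro tendsto_divide_0[OF tendsto_const] filterlim_at_top_imp_at_infinity)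
  from telescope_sums'[OF this] show ?thesis by simp
qed

text \<open>
  On the last sector the Farey map is the translation by \<open>2 silver\<close>, and \<open>m\<close> is the exit time of
  the points in the image.
\<close>

definition last_branch :: "nat \<Rightarrow> real \<Rightarrow> real" where
  "last_branch m w = w - 2 * silver * real m"

lemma last_branch_le:
  assumes "w \<le> silver"
  shows "last_branch (Suc n) w \<le> - silver"
proof -
  have "0 \<le> silver * real n" using silver_bounds by simp
  then show ?thesis using assms by (simp add: last_branch_def algebra_simps)
qed

lemma gauss_last_branch:
  assumes "- silver < w" "w \<le> silver"
  shows "gauss (Finite (last_branch (Suc n) w)) = Finite w"
proof -
  note le = last_branch_le[OF assms(2)]
  have "gauss (Finite (last_branch (Suc n) w)) = Finite (last_branch 0 w)"
  proof (rule gauss_backward_orbit[where k = 7 and x = "\<lambda>n. Finite (last_branch n w)"])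
    show "Finite (last_branch 0 w) \<notin> sector 7"
      using assms by (simp add: sector_eq last_branch_def inj_image_mem_iff[OF inj_Finite])
    show "Finite (last_branch (Suc n) w) \<in> sector 7" for n
      using le[of n] by (simp add: sector_eq)
    show "farey (Finite (last_branch (Suc n) w)) = Finite (last_branch n w)" for n
      using farey_parabolic_7[OF le[of n]] by (simp add: last_branch_def algebra_simps)
  qed simp
  then show ?thesis by (simp add: last_branch_def)
qed

text \<open>
  The interval from \<open>- silver\<close> to \<open>silver\<close> is a fundamental domain of the translation by
  \<open>2 silver\<close>.
\<close>

lemma last_branch_cover:
  assumes "u \<le> - silver"
  obtains n w where "- silver < w" "w \<le> silver" "u = last_branch (Suc n) w"
proof -
  \<comment> \<open>The exit time is the largest \<open>m\<close> for which \<open>u + 2 silver m\<close> does not exceed \<open>silver\<close>.\<close>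
  define t where "t = (silver - u) / (2 * silver)"
  define m where "m = nat \<lfloor>t\<rfloor>"
  have u: "u = silver - 2 * silver * t"
    using silver_bounds by (simp add: t_def)
  have "1 \<le> t"
    using assms silver_bounds by (simp add: t_def)
  then have m: "real m \<le> t" "t < real m + 1" "1 \<le> m"
    unfolding m_def by linarith+
  then obtain n where n: "m = Suc n" by (cases m) auto
  have "2 * silver * real m \<le> 2 * silver * t" "2 * silver * t < 2 * silver * (real m + 1)"
    using m silver_bounds by (simp_all only: mult_le_cancel_left_pos mult_less_cancel_left_pos)
  then have "- silver < u + 2 * silver * real m" "u + 2 * silver * real m \<le> silver"
    unfolding u distrib_left by linarith+
  moreover have "u = last_branch (Suc n) (u + 2 * silver * real m)"
    by (simp add: last_branch_def n)
  ultimately show ?thesis by (rule that)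
qed

lemma inverse_branch_last:
  "inverse_branch {-silver<..silver} (last_branch m) (\<lambda>_. 1) (\<lambda>u. u + 2 * silver * real m)"
  unfolding inverse_branch_def last_branch_def[abs_def]
  by (auto simp: is_interval_1 intro!: derivative_eq_intros)

text \<open>
  The translation by \<open>2 silver\<close> takes \<open>[silver, 3 silver]\<close>, the interval of backward endpoints on
  the last sector, to the adjacent one, so its iterates fill \<open>[3 silver, \<infinity>]\<close>.
\<close>

lemma last_weights_sum:
  assumes "w \<le> silver"
  shows "(\<lambda>n. \<bar>1\<bar> * gauss_density (last_branch (Suc n) w)) sums (1 / (3 * silver - w))"
proof -
  have "gauss_density (last_branch (Suc n) w) =
      1 / ((3 * silver - w) + 2 * silver * real n) - 1 / ((3 * silver - w) + 2 * silver * real (Suc n))" for n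
    using gauss_density_eqs(1)[OF last_branch_le[OF assms, of n]]
    by (simp add: last_branch_def algebra_simps)
  then show ?thesis
    using telescoping_reciprocals_sums[of "2 * silver" "3 * silver - w"] silver_bounds by simp
qed

section \<open>Branches with values in the first sector\<close>

text \<open>
  The Farey map on the first sector is parabolic with fixed point \<open>silver\<close>. In the distance
  \<open>r = silver - u\<close>, its inverse adds \<open>1 / (silver - 1)\<close> to \<open>1 / r\<close>; \<open>cusp_shift m\<close> is the \<open>m\<close>-fold
  iterate.
\<close>

definition cusp_shift :: "nat \<Rightarrow> real \<Rightarrow> real" where
  "cusp_shift m r = r / (1 + real m * r / (silver - 1))"

definition first_branch :: "nat \<Rightarrow> real \<Rightarrow> real" where
  "first_branch m w = silver - cusp_shift m (silver - w)"

definition first_deriv :: "nat \<Rightarrow> real \<Rightarrow> real" where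
  "first_deriv m w = 1 / (1 + real m * (silver - w) / (silver - 1))\<^sup>2"

definition first_inverse :: "nat \<Rightarrow> real \<Rightarrow> real" where
  "first_inverse m u = silver - (silver - u) / (1 - real m * (silver - u) / (silver - 1))"

lemma inverse_cusp_shift:
  assumes "0 < r"
  shows "0 < cusp_shift m r" "1 / cusp_shift m r = 1 / r + real m / (silver - 1)"
proof -
  have "0 < 1 + real m * r / (silver - 1)"
    using assms silver_bounds by (intro add_pos_nonneg) auto
  with assms show "0 < cusp_shift m r" "1 / cusp_shift m r = 1 / r + real m / (silver - 1)"
    by (simp_all add: cusp_shift_def add_divide_distrib)
qed

lemma farey_near_cusp:
  assumes "0 < v" "v < silver - 1"
  shows "farey (Finite (silver - v)) = Finite (silver - 1 / (1 / v - 1 / (silver - 1)))"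
proof -
  have F: "farey (Finite (silver - v)) = Finite (2 * silver - (silver - v + 1) / (silver - v - 1))"
    using assms by (intro farey_parabolic_1) simp_all
  have "1 / (1 / v - 1 / (silver - 1)) = (silver - 1) * v / (silver - v - 1)"
    using assms by (simp add: field_simps)
  also have "\<dots> = (silver - v + 1) / (silver - v - 1) - silver"
    using assms silver_squared by (simp add: field_simps)
  finally show ?thesis using F by simp
qed

lemma cusp_shift_Suc_less:
  assumes "0 < r"
  shows "cusp_shift (Suc n) r < silver - 1"
proof -
  have "1 / (silver - 1) \<le> real (Suc n) / (silver - 1)"
    using silver_bounds by (intro divide_right_mono) auto
  moreover have "0 < 1 / r" using assms by simp
  ultimately have "1 / (silver - 1) < 1 / cusp_shift (Suc n) r"
    unfolding inverse_cusp_shift(2)[OF assms] by linarith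
  then show ?thesis
    using inverse_cusp_shift(1)[OF assms, of "Suc n"] silver_bounds by (simp add: field_simps)
qed

lemma first_branch_bounds:
  assumes "w < silver"
  shows "1 < first_branch (Suc n) w" "first_branch m w < silver"
  using cusp_shift_Suc_less[of "silver - w" n] inverse_cusp_shift(1)[of "silver - w"] assms
  by (simp_all add: first_branch_def)

lemma gauss_first_branch:
  assumes "w \<le> 1"
  shows "gauss (Finite (first_branch (Suc n) w)) = Finite w"
proof -
  define r where "r = silver - w"
  have r: "0 < r" using assms silver_bounds by (simp add: r_def)
  have w: "w < silver" using r by (simp add: r_def)
  have zero: "first_branch 0 w = w" by (simp add: first_branch_def cusp_shift_def)
  have "gauss (Finite (first_branch (Suc n) w)) = Finite (first_branch 0 w)"
  proof (rule gauss_backward_orbit[where k = 1 and x = "\<lambda>n. Finite (first_branch n w)"])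
    show "Finite (first_branch 0 w) \<notin> sector 1"
      using assms zero by (simp add: sector_eq inj_image_mem_iff[OF inj_Finite])
    show "Finite (first_branch (Suc n) w) \<in> sector 1" for n
      using first_branch_bounds[OF w] by (simp add: sector_eq less_imp_le)
    fix n
    have "farey (Finite (first_branch (Suc n) w)) =
        Finite (silver - 1 / (1 / cusp_shift (Suc n) r - 1 / (silver - 1)))"
      unfolding first_branch_def r_def[symmetric]
      by (intro farey_near_cusp inverse_cusp_shift cusp_shift_Suc_less r)
    also have "1 / cusp_shift (Suc n) r - 1 / (silver - 1) = 1 / cusp_shift n r"
      unfolding inverse_cusp_shift(2)[OF r] by (simp add: add_divide_distrib)
    finally show "farey (Finite (first_branch (Suc n) w)) = Finite (first_branch n w)"
      by (simp add: first_branch_def r_def)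
  qed simp
  then show ?thesis by (simp add: zero)
qed

text \<open>
  In the coordinate \<open>t = (silver - 1) / (silver - u)\<close> the first sector is \<open>t > 1\<close> and the Farey map is
  the translation by \<open>- 1\<close>, so the orbit leaves the sector in the fundamental domain
  \<open>0 < t \<le> 1\<close>.
\<close>

lemma first_branch_cover:
  assumes "1 < u" "u < silver"
  obtains n w where "w \<le> 1" "u = first_branch (Suc n) w"
proof -
  define c where "c = silver - 1"
  define t where "t = c / (silver - u)"
  \<comment> \<open>This choice makes \<open>t - m\<close> lie in \<open>{0<..1}\<close>; rounding down could yield \<open>0\<close>.\<close>
  define m where "m = nat (\<lceil>t\<rceil> - 1)"
  have c: "0 < c" using silver_bounds by (simp add: c_def)
  have "1 < t" using assms by (simp add: t_def c_def)
  then have m: "real m < t" "t \<le> real m + 1" "1 \<le> m"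
    unfolding m_def by linarith+
  then obtain n where n: "m = Suc n" by (cases m) auto
  define r where "r = c / (t - real m)"
  have r: "0 < r" using c m by (simp add: r_def)
  have "c / 1 \<le> r" unfolding r_def using m c by (intro divide_left_mono) auto
  then have "silver - r \<le> 1" by (simp add: c_def)
  moreover have "1 / cusp_shift m r = 1 / (silver - u)"
    unfolding inverse_cusp_shift(2)[OF r] c_def[symmetric] using c
    by (simp add: r_def t_def diff_divide_distrib)
  then have "cusp_shift m r = silver - u" by simp
  then have "u = first_branch (Suc n) (silver - r)"
    by (simp add: first_branch_def n)
  ultimately show ?thesis by (rule that)
qed

lemma inverse_branch_first:
  "inverse_branch {..1} (first_branch m) (first_deriv m) (first_inverse m)"
  unfolding inverse_branch_def
proof (intro conjI ballI)
  show "is_interval {..1::real}" by (simp add: is_interval_1)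
  show "first_branch m \<in> borel_measurable borel"
    unfolding first_branch_def[abs_def] cusp_shift_def by measurable
  show "first_deriv m \<in> borel_measurable borel"
    unfolding first_deriv_def[abs_def] by measurable
  show "first_inverse m \<in> borel_measurable borel"
    unfolding first_inverse_def[abs_def] by measurable
  fix w :: real assume "w \<in> {..1}"
  then have r: "0 < silver - w" using silver_bounds by simp
  define d where "d = 1 + real m * (silver - w) / (silver - 1)"
  have d: "0 < d"
    using r silver_bounds unfolding d_def by (intro add_pos_nonneg) auto
  have num: "d - (silver - w) * (real m / (silver - 1)) = 1"
    by (simp add: d_def)
  have "((\<lambda>w. silver - (silver - w) / (1 + real m * (silver - w) / (silver - 1))) has_real_derivative
      0 - ((- 1) * d - (silver - w) * (- (real m / (silver - 1)))) / (d * d)) (at w)"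
    unfolding d_def using d[unfolded d_def] silver_bounds
    by (intro derivative_eq_intros refl) (auto simp: d_def)
  also have "0 - ((- 1) * d - (silver - w) * (- (real m / (silver - 1)))) / (d * d) = 1 / d\<^sup>2"
    using num by (simp add: power2_eq_square minus_divide_left del: minus_divide_left[symmetric])
  finally show "(first_branch m has_real_derivative first_deriv m w) (at w)"
    unfolding first_branch_def[abs_def] cusp_shift_def first_deriv_def d_def .
  show "first_inverse m (first_branch m w) = w"
  proof -
    have "silver - first_branch m w = (silver - w) / d"
      by (simp add: first_branch_def cusp_shift_def d_def)
    moreover have "real m * ((silver - w) / d) / (silver - 1) = (d - 1) / d"
      by (simp add: d_def)
    then have "1 - real m * ((silver - w) / d) / (silver - 1) = 1 / d"
      using d by (simp add: field_simps)
    ultimately show ?thesis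
      using d by (simp add: first_inverse_def)
  qed
qed

text \<open>
  The parabolic map takes \<open>[2 silver - 1, \<infinity>]\<close>, the interval of backward endpoints on the first
  sector, to an adjacent one with right endpoint \<open>2 silver - 1\<close>, and its iterates fill
  \<open>[silver, 2 silver - 1]\<close>.
\<close>

lemma first_weights_sum:
  assumes "w < silver"
  shows "(\<lambda>n. \<bar>first_deriv (Suc n) w\<bar> * gauss_density (first_branch (Suc n) w)) sums
    (1 / (silver - w) - 1 / (2 * silver - 1 - w))"
proof -
  define c r where "c = silver - 1" and "r = silver - w"
  \<comment> \<open>\<open>A m\<close> is the factor by which \<open>cusp_shift m\<close> shrinks the distance \<open>r\<close> to the cusp.\<close>
  define A where "A = (\<lambda>m. 1 + real m * r / c)"
  have c: "0 < c" and r: "0 < r" using silver_bounds assms by (simp_all add: c_def r_def)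
  have A: "0 < A m" for m
    using c r unfolding A_def by (intro add_pos_nonneg) auto
  have Suc: "A (Suc m) = A m + r / c" for m
    by (simp add: A_def add_divide_distrib distrib_right)
  have weight: "\<bar>first_deriv (Suc n) w\<bar> * gauss_density (first_branch (Suc n) w) =
      1 / (r * A (Suc n)) - 1 / (r * A (Suc (Suc n)))" for n
  proof -
    let ?m = "Suc n"
    have "2 * silver - 1 - first_branch ?m w = c + r / A ?m"
      by (simp add: first_branch_def cusp_shift_def A_def c_def r_def)
    also have "\<dots> = c * A (Suc ?m) / A ?m"
      using c A[of ?m] unfolding Suc[of ?m] by (simp add: field_simps)
    finally have "\<bar>first_deriv ?m w\<bar> * gauss_density (first_branch ?m w) =
        1 / (A ?m)\<^sup>2 * (1 / (c * A (Suc ?m) / A ?m))"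
      using gauss_density_eqs(3)[OF first_branch_bounds(1)[OF assms]]
      by (simp add: first_deriv_def A_def c_def r_def)
    also have "\<dots> = 1 / (c * (A ?m * A (Suc ?m)))"
      using A[of ?m] by (simp add: power2_eq_square)
    also have "\<dots> = (A (Suc ?m) - A ?m) / (r * (A ?m * A (Suc ?m)))"
      using c r unfolding Suc[of ?m] by simp
    also have "\<dots> = 1 / (r * A ?m) - 1 / (r * A (Suc ?m))"
      using r A[of ?m] A[of "Suc ?m"] by (simp add: field_simps)
    finally show ?thesis .
  qed
  have "r * A (Suc n) = (r + r\<^sup>2 / c) + r\<^sup>2 / c * real n" for n
    using c by (simp add: A_def power2_eq_square field_simps)
  then have "(\<lambda>n. 1 / (r * A (Suc n)) - 1 / (r * A (Suc (Suc n)))) sums (1 / (r + r\<^sup>2 / c))"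
    using telescoping_reciprocals_sums[of "r\<^sup>2 / c" "r + r\<^sup>2 / c"] c r by simp
  also have "1 / (r + r\<^sup>2 / c) = 1 / r - 1 / (c + r)"
  proof -
    have "r + r\<^sup>2 / c = r * (c + r) / c"
      using c by (simp add: power2_eq_square field_simps)
    then show ?thesis using c r by (simp add: field_simps)
  qed
  finally show ?thesis unfolding weight by (simp add: c_def r_def algebra_simps)
qed

section \<open>Invariance\<close>

text \<open>
  The Gauss map is a common left inverse of the branches, so a common value of two branches has the
  same argument in both.
\<close>

lemma disjoint_inverse_branches:
  assumes "\<And>n w. w \<in> I \<Longrightarrow> gauss (Finite (\<phi> n w)) = Finite w"
    and "\<And>m n w. w \<in> I \<Longrightarrow> \<phi> m w = \<phi> n w \<Longrightarrow> m = n"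
  shows "disjoint_family (\<lambda>n. \<phi> n ` I)"
proof -
  have "m = n" if "w \<in> I" "w' \<in> I" "\<phi> m w = \<phi> n w'" for m n w w'
    using assms(1)[OF that(1), of m] assms(1)[OF that(2), of n] assms(2)[of w m n] that by auto
  then show ?thesis by (fastforce simp: disjoint_family_on_def)
qed

text \<open>
  The exit points of the first sector are those outside it, \<open>w \<le> 1\<close>, and likewise for the last
  sector. The middle branches are restricted to \<open>w < silver\<close>, which loses only a single point.
\<close>

definition branch_domain :: "nat \<Rightarrow> real set" where
  "branch_domain i = (if i = 1 then {..1} else if i = 7 then {-silver<..silver} else {..<silver})"

definition branch_weight :: "nat \<Rightarrow> real \<Rightarrow> real" where
  "branch_weight i w =
     (if i = 1 then 1 / (silver - w) - 1 / (2 * silver - 1 - w)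
      else if i = 7 then 1 / (3 * silver - w)
      else \<bar>middle_deriv i w\<bar> * gauss_density (middle_branch i w))"

definition sector_preimage :: "nat \<Rightarrow> real set \<Rightarrow> real set" where
  "sector_preimage i B =
     (if i = 1 then (\<Union>n. first_branch (Suc n) ` (branch_domain i \<inter> B))
      else if i = 7 then (\<Union>n. last_branch (Suc n) ` (branch_domain i \<inter> B))
      else middle_branch i ` (branch_domain i \<inter> B))"

lemma nn_integral_sector_preimage:
  assumes i: "i \<in> {1..7}" and B: "B \<in> sets borel"
  shows "sector_preimage i B \<in> sets borel"
    and "(\<integral>\<^sup>+u\<in>sector_preimage i B. ennreal (gauss_density u) \<partial>lborel) =
      (\<integral>\<^sup>+w\<in>branch_domain i \<inter> B. ennreal (branch_weight i w) \<partial>lborel)"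
proof -
  consider "i = 1" | "i = 7" | "i \<in> {2..6}" using i by force
  then have "sector_preimage i B \<in> sets borel \<and>
    (\<integral>\<^sup>+u\<in>sector_preimage i B. ennreal (gauss_density u) \<partial>lborel) =
      (\<integral>\<^sup>+w\<in>branch_domain i \<inter> B. ennreal (branch_weight i w) \<partial>lborel)"
  proof cases
    case 1
    have disj: "disjoint_family (\<lambda>n. first_branch (Suc n) ` {..1})"
    proof (rule disjoint_inverse_branches)
      fix m n :: nat and w :: real
      assume w: "w \<in> {..1}" and eq: "first_branch (Suc m) w = first_branch (Suc n) w"
      have "0 < silver - w" using w silver_bounds by simp
      note recip = inverse_cusp_shift(2)[OF this]
      have "cusp_shift (Suc m) (silver - w) = cusp_shift (Suc n) (silver - w)"
        using eq by (simp add: first_branch_def)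
      then have "1 / (silver - w) + real (Suc m) / (silver - 1) =
          1 / (silver - w) + real (Suc n) / (silver - 1)"
        by (simp only: recip[symmetric])
      then show "m = n" using silver_bounds by simp
    qed (simp add: gauss_first_branch)
    have "(\<integral>\<^sup>+u\<in>(\<Union>n. first_branch (Suc n) ` ({..1} \<inter> B)). ennreal (gauss_density u) \<partial>lborel) =
        (\<integral>\<^sup>+w\<in>{..1} \<inter> B. ennreal (1 / (silver - w) - 1 / (2 * silver - 1 - w)) \<partial>lborel)"
    proof (rule inverse_branches_integral[OF inverse_branch_first B disj gauss_density_borel])
      fix n :: nat and w :: real assume "w \<in> {..1}"
      then have w: "w < silver" using silver_bounds by simp
      show "0 \<le> gauss_density (first_branch (Suc n) w)"
        using first_branch_bounds(2)[OF w] by (intro gauss_density_nonneg less_imp_le)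
      show "(\<lambda>n. \<bar>first_deriv (Suc n) w\<bar> * gauss_density (first_branch (Suc n) w)) sums
          (1 / (silver - w) - 1 / (2 * silver - 1 - w))"
        by (rule first_weights_sum[OF w])
    qed
    moreover have "(\<Union>n. first_branch (Suc n) ` ({..1} \<inter> B)) \<in> sets borel"
      by (intro sets.countable_nat_UN image_subsetI inverse_branch_image_borel[OF inverse_branch_first B])
    ultimately show ?thesis
      by (simp add: 1 sector_preimage_def branch_domain_def branch_weight_def)
  next
    case 2
    have disj: "disjoint_family (\<lambda>n. last_branch (Suc n) ` {-silver<..silver})"
      using silver_bounds
      by (intro disjoint_inverse_branches) (auto simp: gauss_last_branch, simp add: last_branch_def)
    have "(\<integral>\<^sup>+u\<in>(\<Union>n. last_branch (Suc n) ` ({-silver<..silver} \<inter> B)). ennreal (gauss_density u) \<partial>lborel) =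
        (\<integral>\<^sup>+w\<in>{-silver<..silver} \<inter> B. ennreal (1 / (3 * silver - w)) \<partial>lborel)"
    proof (rule inverse_branches_integral[OF inverse_branch_last B disj gauss_density_borel])
      fix n :: nat and w :: real assume "w \<in> {-silver<..silver}"
      then have w: "w \<le> silver" by simp
      have "last_branch (Suc n) w \<le> silver"
        using last_branch_le[OF w, of n] silver_bounds by linarith
      then show "0 \<le> gauss_density (last_branch (Suc n) w)"
        by (rule gauss_density_nonneg)
      show "(\<lambda>n. \<bar>1\<bar> * gauss_density (last_branch (Suc n) w)) sums (1 / (3 * silver - w))"
        by (rule last_weights_sum[OF w])
    qed
    moreover have "(\<Union>n. last_branch (Suc n) ` ({-silver<..silver} \<inter> B)) \<in> sets borel"
      by (intro sets.countable_nat_UN image_subsetI inverse_branch_image_borel[OF inverse_branch_last B])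
    ultimately show ?thesis
      by (simp add: 2 sector_preimage_def branch_domain_def branch_weight_def)
  next
    case 3
    have "0 \<le> gauss_density (middle_branch i w)" if "w \<in> {..<silver}" for w
      using middle_branch_in_sector(4)[OF 3, of w] that silver_bounds
      by (intro gauss_density_nonneg) simp
    then show ?thesis
      using 3 inverse_branch_image_borel[OF inverse_branch_middle B]
        inverse_branch_integral[OF inverse_branch_middle B gauss_density_borel]
      by (simp add: sector_preimage_def branch_domain_def branch_weight_def)
  qed
  then show "sector_preimage i B \<in> sets borel"
    "(\<integral>\<^sup>+u\<in>sector_preimage i B. ennreal (gauss_density u) \<partial>lborel) =
      (\<integral>\<^sup>+w\<in>branch_domain i \<inter> B. ennreal (branch_weight i w) \<partial>lborel)" by blast+
qed

lemma sector_preimage_subset: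
  assumes i: "i \<in> {1..7}"
  shows "Finite ` sector_preimage i B \<subseteq> sector i \<inter> gauss -` Finite ` B"
proof -
  consider "i = 1" | "i = 7" | "i \<in> {2..6}" using i by force
  then show ?thesis
  proof cases
    case 1
    have "Finite (first_branch (Suc n) w) \<in> sector 1" if "w \<le> 1" for n w
      using first_branch_bounds[of w] that silver_bounds by (simp add: sector_eq less_imp_le)
    then show ?thesis
      by (auto simp: 1 sector_preimage_def branch_domain_def gauss_first_branch)
  next
    case 2
    then show ?thesis
      by (auto simp: sector_eq sector_preimage_def branch_domain_def gauss_last_branch last_branch_le)
  next
    case 3
    then show ?thesis
      by (auto simp: sector_preimage_def branch_domain_def gauss_middle_branch middle_branch_in_sector)
  qed
qed

text \<open>
  The excluded points are the parabolic fixed point \<open>silver\<close> and the right endpoints of the middle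
  sectors, which map to \<open>silver\<close> or \<open>\<infinity>\<close>.
\<close>

lemma sector_preimages_cover:
  assumes u: "u \<le> silver" "u \<notin> {silver, 1, silver - 2, 0, 2 - silver, -1}"
    and B: "gauss (Finite u) \<in> Finite ` B"
  shows "u \<in> (\<Union>i\<in>{1..7}. sector_preimage i B)"
proof -
  have middle: ?thesis if i: "i \<in> {2..6}" and im: "u \<in> middle_branch i ` {..<silver}" for i
  proof -
    from im obtain w where "w < silver" "u = middle_branch i w" by auto
    moreover from this have "w \<in> B" using B gauss_middle_branch[OF i] by auto
    ultimately have "u \<in> sector_preimage i B"
      using i by (auto simp: sector_preimage_def branch_domain_def)
    then show ?thesis using i by (intro UN_I[of i]) auto
  qed
  consider "1 < u" | "u \<in> {silver - 2<..<1}" | "u \<in> {0<..<silver - 2}" | "u \<in> {2 - silver<..<0}"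
    | "u \<in> {-1<..<2 - silver}" | "u \<in> {-silver<..<-1}" | "u \<le> - silver"
    using u unfolding greaterThanLessThan_iff insert_iff by linarith
  then show ?thesis
  proof cases
    case 1
    moreover have "u < silver" using u by auto
    ultimately obtain n w where w: "w \<le> 1" "u = first_branch (Suc n) w"
      by (rule first_branch_cover)
    then have "w \<in> B" using B gauss_first_branch by auto
    with w have "u \<in> first_branch (Suc n) ` ({..1} \<inter> B)"
      by auto
    then have "u \<in> sector_preimage 1 B"
      by (auto simp: sector_preimage_def branch_domain_def)
    then show ?thesis by (intro UN_I[of 1]) auto
  next
    case 7
    then obtain n w where w: "- silver < w" "w \<le> silver" "u = last_branch (Suc n) w"
      using last_branch_cover by blast
    then have "w \<in> B" using B gauss_last_branch by auto
    with w have "u \<in> last_branch (Suc n) ` ({-silver<..silver} \<inter> B)"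
      by auto
    then have "u \<in> sector_preimage 7 B"
      by (auto simp: sector_preimage_def branch_domain_def)
    then show ?thesis by (intro UN_I[of 7]) auto
  qed (use middle[of 2] middle[of 3] middle[of 4] middle[of 5] middle[of 6] in
      \<open>simp_all only: middle_branch_image, simp_all\<close>)
qed

text \<open>
  The density is a fixed point of the transfer operator: the intervals \<open>[silver, 2 silver - 1]\<close>
  (if \<open>w \<le> 1\<close>), \<open>[2 silver - 1, 3 silver]\<close> and \<open>[3 silver, \<infinity>]\<close> (if \<open>w > - silver\<close>) make up the
  interval of backward endpoints that defines the density at \<open>w\<close>.
\<close>

lemma branch_weights_sum:
  assumes w: "w < silver"
  shows "(\<Sum>i\<in>{1..7}. ennreal (branch_weight i w) * indicator (branch_domain i) w) =
    ennreal (gauss_density w)"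
proof -
  have nonneg: "0 \<le> branch_weight i w" if i: "i \<in> {1..7}" for i
  proof -
    consider "i = 1" | "i = 7" | "i \<in> {2..6}" using i by force
    then show ?thesis
    proof cases
      case 1
      have "1 / (2 * silver - 1 - w) \<le> 1 / (silver - w)"
        using w silver_bounds by (intro frac_le) linarith+
      then show ?thesis by (simp add: 1 branch_weight_def)
    next
      case 2
      then show ?thesis using w silver_bounds by (simp add: branch_weight_def)
    next
      case 3
      then have "0 \<le> gauss_density (middle_branch i w)"
        using middle_branch_in_sector(4)[OF 3 w] silver_bounds by (intro gauss_density_nonneg) simp
      with 3 show ?thesis by (simp add: branch_weight_def)
    qed
  qed
  have "{1..7} = insert 1 (insert 7 {2..6::nat})" by auto
  then have split_sum: "(\<Sum>i\<in>{1..7}. f i) = f 1 + f 7 + (\<Sum>i\<in>{2..6}. f i)" for f :: "nat \<Rightarrow> real"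
    by simp
  have "(\<Sum>i\<in>{1..7}. ennreal (branch_weight i w) * indicator (branch_domain i) w) =
      (\<Sum>i\<in>{1..7}. ennreal (branch_weight i w * indicator (branch_domain i) w))"
    by (intro sum.cong refl) (auto split: split_indicator)
  also have "\<dots> = ennreal (\<Sum>i\<in>{1..7}. branch_weight i w * indicator (branch_domain i) w)"
    using nonneg by (intro sum_ennreal) simp
  also have "(\<Sum>i\<in>{1..7}. branch_weight i w * indicator (branch_domain i) w) =
      branch_weight 1 w * indicator {..1} w + branch_weight 7 w * indicator {-silver<..silver} w +
      (\<Sum>i\<in>{2..6}. \<bar>middle_deriv i w\<bar> * gauss_density (middle_branch i w))"
  proof -
    have "(\<Sum>i\<in>{2..6}. branch_weight i w * indicator (branch_domain i) w) =
        (\<Sum>i\<in>{2..6}. \<bar>middle_deriv i w\<bar> * gauss_density (middle_branch i w))"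
      using w by (intro sum.cong refl) (auto simp: branch_domain_def branch_weight_def)
    then show ?thesis
      unfolding split_sum by (simp only: branch_domain_def) simp
  qed
  also have "\<dots> = gauss_density w"
    unfolding middle_weights_sum[OF w]
    using w silver_bounds gauss_density_eqs[of w]
    by (auto simp: branch_weight_def indicator_def)
  finally show ?thesis .
qed

theorem proposition5p3:
  shows "\<forall>D \<in> sets mu_gauss.
           gauss -` D \<inter> Sigma_oct \<in> sets mu_gauss \<and>
           emeasure mu_gauss (gauss -` D \<inter> Sigma_oct) = emeasure mu_gauss D"
proof
  fix D assume "D \<in> sets mu_gauss"
  then obtain B where B: "B \<in> sets borel" "B \<subseteq> {..silver}" and D: "D = Finite ` B"
    by (auto simp: sets_mu_gauss)
  define A where "A = {u \<in> {..silver}. gauss (Finite u) \<in> D}"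
  define U where "U = (\<Union>i\<in>{1..7}. sector_preimage i B)"
  define E where "E = {silver, 1, silver - 2, 0, 2 - silver, -1}"
  have pre: "gauss -` D \<inter> Sigma_oct = Finite ` A"
    by (auto simp: A_def Sigma_oct_eq)
  have sub: "Finite ` sector_preimage i B \<subseteq> sector i" "Finite ` sector_preimage i B \<subseteq> gauss -` D"
    if "i \<in> {1..7}" for i
    using sector_preimage_subset[OF that, of B] unfolding D by auto
  have "Finite ` U \<subseteq> gauss -` D \<inter> Sigma_oct"
    using sub unfolding U_def Sigma_oct_def image_UN by blast
  then have "U \<subseteq> A"
    unfolding pre by (simp add: inj_image_subset_iff[OF inj_Finite])
  moreover have "A \<subseteq> U \<union> E"
    using sector_preimages_cover[of _ B] by (auto simp: A_def U_def E_def D)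
  ultimately have A: "A = U \<union> (A \<inter> E)" by auto
  have fin: "finite (A \<inter> E)" by (simp add: E_def)
  have U: "U \<in> sets borel"
    unfolding U_def using B(1) by (intro sets.finite_UN nn_integral_sector_preimage) auto
  have A_borel: "A \<in> sets borel"
    by (subst A) (use U fin in \<open>auto intro: borel_closed finite_imp_closed\<close>)
  have A_sub: "A \<subseteq> {..silver}" by (auto simp: A_def)

  have disj: "disjoint_family_on (\<lambda>i. sector_preimage i B) {1..7}"
    using sub(1) sector_unique unfolding disjoint_family_on_def by blast
  have dens [measurable]: "(\<lambda>u. ennreal (gauss_density u)) \<in> borel_measurable lborel"
    by measurable
  have "emeasure mu_gauss (Finite ` A) = (\<integral>\<^sup>+u\<in>A. ennreal (gauss_density u) \<partial>lborel)"
    by (rule emeasure_mu_gauss[OF A_borel A_sub])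
  also have "\<dots> = (\<integral>\<^sup>+u\<in>U. ennreal (gauss_density u) \<partial>lborel)"
  proof (rule nn_integral_cong_AE)
    have "AE u in lborel. u \<notin> A \<inter> E"
      using finite_imp_null_set_lborel[OF fin] by (rule AE_not_in)
    then show "AE u in lborel. ennreal (gauss_density u) * indicator A u =
        ennreal (gauss_density u) * indicator U u"
      by eventually_elim (use A in \<open>auto split: split_indicator\<close>)
  qed
  also have "\<dots> = (\<integral>\<^sup>+u. (\<Sum>i\<in>{1..7}. ennreal (gauss_density u) * indicator (sector_preimage i B) u) \<partial>lborel)"
    unfolding U_def by (simp only: indicator_UN_disjoint[OF finite_atLeastAtMost disj] sum_distrib_left)
  also have "\<dots> = (\<Sum>i\<in>{1..7}. \<integral>\<^sup>+u\<in>sector_preimage i B. ennreal (gauss_density u) \<partial>lborel)"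
    using nn_integral_sector_preimage(1)[OF _ B(1)] by (intro nn_integral_sum) auto
  also have "\<dots> = (\<Sum>i\<in>{1..7}. \<integral>\<^sup>+w. ennreal (branch_weight i w) * indicator (branch_domain i \<inter> B) w \<partial>lborel)"
    by (intro sum.cong refl nn_integral_sector_preimage B)
  also have "\<dots> = (\<integral>\<^sup>+w. (\<Sum>i\<in>{1..7}. ennreal (branch_weight i w) * indicator (branch_domain i \<inter> B) w) \<partial>lborel)"
  proof (rule nn_integral_sum[symmetric])
    fix i
    have [measurable]: "branch_domain i \<inter> B \<in> sets borel"
      using B(1) by (simp add: branch_domain_def)
    have [measurable]: "middle_branch i \<in> borel_measurable borel" "middle_deriv i \<in> borel_measurable borel"
      using inverse_branch_middle[of i] by (simp_all add: inverse_branch_def)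
    have [measurable]: "branch_weight i \<in> borel_measurable borel"
      unfolding branch_weight_def[abs_def] by measurable
    show "(\<lambda>w. ennreal (branch_weight i w) * indicator (branch_domain i \<inter> B) w) \<in> borel_measurable lborel"
      by measurable
  qed
  also have "\<dots> = (\<integral>\<^sup>+w\<in>B. ennreal (gauss_density w) \<partial>lborel)"
  proof (rule nn_integral_cong_AE)
    have "AE w in lborel. w \<noteq> silver" by (rule AE_lborel_singleton)
    then show "AE w in lborel. (\<Sum>i\<in>{1..7}. ennreal (branch_weight i w) * indicator (branch_domain i \<inter> B) w) =
        ennreal (gauss_density w) * indicator B w"
    proof eventually_elim
      case (elim w)
      show ?case
      proof (cases "w \<in> B")
        case True
        with elim B(2) have "w < silver" by force
        from branch_weights_sum[OF this] True show ?thesis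
          by (simp add: indicator_inter_arith)
      qed simp
    qed
  qed
  also have "\<dots> = emeasure mu_gauss D"
    unfolding D by (rule emeasure_mu_gauss[OF B, symmetric])
  finally show "gauss -` D \<inter> Sigma_oct \<in> sets mu_gauss \<and>
      emeasure mu_gauss (gauss -` D \<inter> Sigma_oct) = emeasure mu_gauss D"
    unfolding pre using A_borel A_sub by (auto simp: sets_mu_gauss)
qed

end
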